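(* Let $(X,\sigma)$ be an infinite one-sided linearly recurrent shift with recurrence constant $K$. Then every endomorphism $\Phi$ of $(X,\sigma)$ is a $k$-th root of a power of the shift for some positive integer $k\le 2(K+1)(2K+3)^2$; that is, there exist an integer $k$ with $1\le k\le 2(K+1)(2K+3)^2$ and an integer $n\ge 0$ such that $\Phi^k=\sigma^n$.
   Context: Let $\mathcal A$ be a finite alphabet with the discrete topology and $\mathbb N_0=\{0,1,2,\dots\}$. A one-sided shift $(X,\sigma)$ is a closed shift-invariant subset $X\subseteq\mathcal A^{\mathbb N_0}$ (product topology) with the left shift $\sigma$; it is minimal if every forward orbit is dense. An endomorphism of $(X,\sigma)$ is a map $\Phi:X\to X$ that is continuous, onto, and commutes with $\sigma$. The language $\mathcal L_X$ is the set of all finite words occurring in points of $X$; $\ell(u)$ is the length of a word $u$. For nonempty $u\in\mathcal L_X$ and $w\in\mathcal L_X$, $w$ is a return word to $u$ if (a) $u$ is a prefix of $w$, (b) $wu\in\mathcal L_X$, and (c) there are exactly two occurrences of $u$ in $wu$. (Condition (a) is as stated by the paper.) A minimal one-sided shift $(X,\sigma)$ is linearly recurrent if there is a constant $K$ such that for every nonempty word $u\in\mathcal L_X$ and every return word $w$ to $u$, $\ell(w)\le K\ell(u)$. Such a $K$ is called a recurrence constant. *)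

theory Defs
  imports "HOL-Analysis.Analysis" "HOL-Library.Sublist"
begin

text \<open>Points of the full shift over a finite alphabet \<open>A\<close> are functions \<open>nat \<Rightarrow> 'a\<close> with values in
  \<open>A\<close>; the type \<open>'a\<close> itself carries no topology.\<close>

definition full_shift_topology :: "'a set \<Rightarrow> (nat \<Rightarrow> 'a) topology" where
  "full_shift_topology A = product_topology (\<lambda>_. discrete_topology A) UNIV"

definition left_shift :: "(nat \<Rightarrow> 'a) \<Rightarrow> (nat \<Rightarrow> 'a)" where
  "left_shift x = (\<lambda>i. x (Suc i))"

text \<open>\<^const>\<open>closedin\<close> includes \<open>X \<subseteq> topspace\<close>, i.e. all points of \<open>X\<close> take values in \<open>A\<close>.\<close>

definition one_sided_shift :: "'a set \<Rightarrow> (nat \<Rightarrow> 'a) set \<Rightarrow> bool" where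
  "one_sided_shift A X \<longleftrightarrow>
     finite A \<and> closedin (full_shift_topology A) X \<and> left_shift ` X \<subseteq> X"

definition minimal_shift :: "'a set \<Rightarrow> (nat \<Rightarrow> 'a) set \<Rightarrow> bool" where
  "minimal_shift A X \<longleftrightarrow>
     one_sided_shift A X \<and>
     (\<forall>x\<in>X. subtopology (full_shift_topology A) X closure_of
               range (\<lambda>n. (left_shift ^^ n) x) = X)"

text \<open>Only the values of \<open>\<Phi>\<close> on \<open>X\<close> matter.\<close>

definition shift_endomorphism ::
    "'a set \<Rightarrow> (nat \<Rightarrow> 'a) set \<Rightarrow> ((nat \<Rightarrow> 'a) \<Rightarrow> (nat \<Rightarrow> 'a)) \<Rightarrow> bool" where
  "shift_endomorphism A X \<Phi> \<longleftrightarrow>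
     continuous_map (subtopology (full_shift_topology A) X)
                    (subtopology (full_shift_topology A) X) \<Phi> \<and>
     \<Phi> ` X = X \<and>
     (\<forall>x\<in>X. \<Phi> (left_shift x) = left_shift (\<Phi> x))"

definition language :: "(nat \<Rightarrow> 'a) set \<Rightarrow> 'a list set" where
  "language X = {map x [i..<j] | x i j. x \<in> X}"

definition occurrences :: "'a list \<Rightarrow> 'a list \<Rightarrow> nat set" where
  "occurrences u v = {i. i \<le> length v \<and> prefix u (drop i v)}"

text \<open>Note that \<open>u\<close> is required to be a prefix of \<open>w\<close> itself,
  not merely of \<open>w @ u\<close>, so \<open>length u \<le> length w\<close>.\<close>

definition return_word :: "(nat \<Rightarrow> 'a) set \<Rightarrow> 'a list \<Rightarrow> 'a list \<Rightarrow> bool" where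
  "return_word X u w \<longleftrightarrow>
     u \<in> language X \<and> u \<noteq> [] \<and> w \<in> language X \<and>
     prefix u w \<and> w @ u \<in> language X \<and> card (occurrences u (w @ u)) = 2"

definition recurrence_constant :: "(nat \<Rightarrow> 'a) set \<Rightarrow> real \<Rightarrow> bool" where
  "recurrence_constant X K \<longleftrightarrow>
     (\<forall>u w. u \<in> language X \<longrightarrow> u \<noteq> [] \<longrightarrow> return_word X u w \<longrightarrow>
        real (length w) \<le> K * real (length u))"

definition linearly_recurrent :: "'a set \<Rightarrow> (nat \<Rightarrow> 'a) set \<Rightarrow> bool" where
  "linearly_recurrent A X \<longleftrightarrow> minimal_shift A X \<and> (\<exists>K. recurrence_constant X K)"

end

theory Submission
  imports Defs
begin

text \<open>Linear recurrence makes endomorphisms almost injective: if \<open>\<Phi> y = \<Phi> y'\<close>, then \<open>y\<close>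
  and \<open>y'\<close> agree from some coordinate on. Now take two distinct points with the same shift and follow
  them along backward \<open>\<Phi>\<close>-orbits; at each stage the two points remain distinct and eventually equal,
  so some shift of theirs is a branch point, a point with at least two preimages under the shift. As the
  number of words of length \<open>n\<close> is at most \<open>K n + 1\<close>, there are at most \<open>K\<close> branch points (for integral \<open>K\<close>), and
  two stages with the same branch point give \<open>\<Phi>\<^sup>k (\<sigma>\<^sup>p x) = \<sigma>\<^sup>q x\<close> with \<open>k \<le> K\<close>.
  Density of the orbit of \<open>x\<close> and non-injectivity of \<open>\<sigma>\<close> turn this into \<open>\<Phi>\<^sup>k = \<sigma>\<^bsup>q - p\<^esup>\<close>.\<close>

section \<open>Limits and the topology of the full shift\<close>

lemma left_shift_funpow: "(left_shift ^^ n) x i = x (n + i)"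
  by (induction n arbitrary: i) (simp_all add: left_shift_def)

lemma left_shift_funpow_eqI:
  "(\<And>i. x (m + i) = y (n + i)) \<Longrightarrow> (left_shift ^^ m) x = (left_shift ^^ n) y"
  by (rule ext) (simp add: left_shift_funpow)

text \<open>Sequential compactness: \<open>x\<close> is an accumulation point of the sequence
  \<open>F\<close>. A prefix shared by infinitely many \<open>F n\<close> is extended letter by
  letter, each time by the pigeonhole principle.\<close>

lemma koenig:
  fixes F :: "nat \<Rightarrow> nat \<Rightarrow> 'b"
  assumes "finite B" and F: "\<And>n i. F n i \<in> B"
  obtains x where "\<And>m. infinite {n. \<forall>i<m. F n i = x i}"
proof -
  let ?P = "\<lambda>m f. infinite {n. \<forall>i<m. F n i = f i}"
  have "\<exists>s. \<forall>m. ?P m (s m) \<and> (\<forall>i<m. s (Suc m) i = s m i)"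
  proof (rule dependent_nat_choice)
    show "\<exists>f. ?P 0 f" by simp
  next
    fix f m assume inf: "?P m f"
    let ?S = "{n. \<forall>i<m. F n i = f i}"
    have "finite ((\<lambda>n. F n m) ` ?S)"
      by (rule finite_subset[OF _ \<open>finite B\<close>]) (use F in auto)
    from pigeonhole_infinite[OF inf this] obtain a
      where a: "a \<in> ?S" "infinite {n \<in> ?S. F n m = F a m}" by blast
    have "{n \<in> ?S. F n m = F a m} = {n. \<forall>i<Suc m. F n i = (f(m := F a m)) i}"
      by (auto simp: less_Suc_eq)
    with a have "?P (Suc m) (f(m := F a m))" by metis
    then show "\<exists>g. ?P (Suc m) g \<and> (\<forall>i<m. g i = f i)"
      by (intro exI[of _ "f(m := F a m)"]) auto
  qed
  then obtain s where s: "\<And>m. ?P m (s m)" "\<And>m i. i < m \<Longrightarrow> s (Suc m) i = s m i"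
    by blast
  \<comment> \<open>Only the first \<open>m\<close> values of \<open>s m\<close> matter; the
    diagonal \<open>s (Suc i) i\<close> collects the letters once they are fixed.\<close>
  have stable: "s m i = s (Suc i) i" if "i < m" for m i
    using that by (induction m) (auto simp: s(2) less_Suc_eq)
  have "infinite {n. \<forall>i<m. F n i = s (Suc i) i}" for m
    using s(1)[of m] by (simp add: stable[of _ m, symmetric])
  then show thesis by (rule that[of "\<lambda>i. s (Suc i) i"])
qed

lemma topspace_full_shift: "topspace (full_shift_topology A) = {x. \<forall>i. x i \<in> A}"
  by (auto simp: full_shift_topology_def PiE_iff)

lemma openin_full_shift_cylinder:
  assumes "openin (full_shift_topology A) S" and "x \<in> S"
  shows "\<exists>m. \<forall>y. (\<forall>i. y i \<in> A) \<and> (\<forall>i<m. y i = x i) \<longrightarrow> y \<in> S"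
proof -
  from assms obtain U where U: "finite {i. U i \<noteq> A}" "x \<in> Pi\<^sub>E UNIV U" "Pi\<^sub>E UNIV U \<subseteq> S"
    by (auto simp: full_shift_topology_def openin_product_topology_alt)
  from U(1) obtain m where m: "\<And>i. U i \<noteq> A \<Longrightarrow> i < m"
    by (auto simp: finite_nat_set_iff_bounded)
  show ?thesis
  proof (intro exI[of _ m] allI impI)
    fix y assume y: "(\<forall>i. y i \<in> A) \<and> (\<forall>i<m. y i = x i)"
    have "y i \<in> U i" for i
      using m[of i] y U(2) by (cases "U i = A") (auto simp: PiE_iff)
    with U(3) show "y \<in> S" by (auto simp: PiE_iff)
  qed
qed

lemma openin_cylinder:
  assumes "\<And>i. x i \<in> A"
  shows "openin (full_shift_topology A) {y. (\<forall>i. y i \<in> A) \<and> (\<forall>i<m. y i = x i)}"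
proof -
  have eq: "{y. (\<forall>i. y i \<in> A) \<and> (\<forall>i<m. y i = x i)} = Pi\<^sub>E UNIV (\<lambda>i. if i < m then {x i} else A)"
    using assms by (auto simp: PiE_iff split: if_splits)
  have "{i. (if i < m then {x i} else A) \<noteq> A} \<subseteq> {..<m}" by auto
  then have "finite {i. (if i < m then {x i} else A) \<noteq> A}" by (rule finite_subset) simp
  then show ?thesis
    unfolding eq full_shift_topology_def using assms
    by (subst openin_PiE_gen) auto
qed

lemma closedin_full_shiftD:
  assumes "closedin (full_shift_topology A) X" and "\<And>m. \<exists>y\<in>X. \<forall>i<m. y i = x i"
  shows "x \<in> X"
proof (rule ccontr)
  assume "x \<notin> X"
  have XA: "y i \<in> A" if "y \<in> X" for y i
    using closedin_subset[OF assms(1)] that by (auto simp: topspace_full_shift)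
  have "x i \<in> A" for i using assms(2)[of "Suc i"] XA by (metis lessI)
  with \<open>x \<notin> X\<close> have x: "x \<in> topspace (full_shift_topology A) - X" by (simp add: topspace_full_shift)
  have "openin (full_shift_topology A) (topspace (full_shift_topology A) - X)"
    using assms(1) by (simp add: closedin_def)
  from openin_full_shift_cylinder[OF this x] obtain m where "\<forall>y. (\<forall>i. y i \<in> A) \<and> (\<forall>i<m. y i = x i) \<longrightarrow> y \<notin> X"
    by auto
  with assms(2)[of m] XA show False by metis
qed

lemma minimal_shift_dense:
  assumes "minimal_shift A X" and "x \<in> X" and "y \<in> X"
  obtains n where "\<And>i. i < m \<Longrightarrow> x (n + i) = y i"
proof -
  have XA: "z i \<in> A" if "z \<in> X" for z i
    using closedin_subset[of "full_shift_topology A" X] assms(1) that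
    by (auto simp: minimal_shift_def one_sided_shift_def topspace_full_shift)
  have "y \<in> subtopology (full_shift_topology A) X closure_of range (\<lambda>n. (left_shift ^^ n) x)"
    using assms by (simp add: minimal_shift_def)
  note dense = conjunct2[OF this[unfolded in_closure_of], rule_format]
  have "openin (subtopology (full_shift_topology A) X)
      ({z. (\<forall>i. z i \<in> A) \<and> (\<forall>i<m. z i = y i)} \<inter> X)"
    using openin_cylinder[of y A m] XA[OF assms(3)] by (auto simp: openin_subtopology)
  from dense[OF conjI[OF _ this]] obtain n where "\<forall>i<m. (left_shift ^^ n) x i = y i"
    using XA[OF assms(3)] assms(3) by auto
  then show thesis by (intro that[of n]) (simp add: left_shift_funpow)
qed

text \<open>The Curtis-Hedlund-Lyndon theorem. Otherwise pairs agreeing on ever longer prefixes,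
  with images that differ at 0, would accumulate at one point \<open>x\<close> and contradict
  continuity there.\<close>

lemma endomorphism_local_rule:
  assumes "one_sided_shift A X" and "shift_endomorphism A X \<Phi>"
  obtains r where
    "\<And>x y. x \<in> X \<Longrightarrow> y \<in> X \<Longrightarrow> (\<And>i. i < r \<Longrightarrow> x i = y i) \<Longrightarrow> \<Phi> x 0 = \<Phi> y 0"
proof (rule ccontr)
  assume "\<not> thesis"
  with that have "\<forall>r. \<exists>x y. x \<in> X \<and> y \<in> X \<and> (\<forall>i<r. x i = y i) \<and> \<Phi> x 0 \<noteq> \<Phi> y 0"
    by meson
  then obtain f g where fg: "\<And>r. f r \<in> X" "\<And>r. g r \<in> X"
      "\<And>r i. i < r \<Longrightarrow> f r i = g r i" "\<And>r. \<Phi> (f r) 0 \<noteq> \<Phi> (g r) 0"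
    by metis
  have closed: "closedin (full_shift_topology A) X" and "finite A"
    using assms(1) by (simp_all add: one_sided_shift_def)
  have XA: "z i \<in> A" if "z \<in> X" for z i
    using closedin_subset[OF closed] that by (auto simp: topspace_full_shift)
  obtain x where x: "\<And>m. infinite {n. \<forall>i<m. f n i = x i}"
    using koenig[OF \<open>finite A\<close>, of f] XA fg(1) by blast
  have "\<exists>n. \<forall>i<m. f n i = x i" for m
    using not_finite_existsD[OF x[of m]] by blast
  then have "x \<in> X"
    by (intro closedin_full_shiftD[OF closed]) (use fg(1) in blast)
  have "\<Phi> x \<in> X" using assms(2) \<open>x \<in> X\<close> by (auto simp: shift_endomorphism_def)
  have "openin (subtopology (full_shift_topology A) X)
      ({z. (\<forall>i. z i \<in> A) \<and> (\<forall>i<1. z i = \<Phi> x i)} \<inter> X)"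
    using openin_cylinder[of "\<Phi> x" A 1] XA[OF \<open>\<Phi> x \<in> X\<close>] by (auto simp: openin_subtopology)
  then have "openin (subtopology (full_shift_topology A) X)
     {z \<in> topspace (subtopology (full_shift_topology A) X).
        \<Phi> z \<in> {z. (\<forall>i. z i \<in> A) \<and> (\<forall>i<1. z i = \<Phi> x i)} \<inter> X}" (is "openin _ ?S")
    using assms(2) by (auto simp: shift_endomorphism_def continuous_map_def)
  then obtain V where V: "openin (full_shift_topology A) V" "?S = V \<inter> X"
    by (auto simp: openin_subtopology)
  have "x \<in> ?S"
    using \<open>x \<in> X\<close> \<open>\<Phi> x \<in> X\<close> XA by (auto simp: topspace_full_shift)
  then have "x \<in> V" using V(2) by blast
  from openin_full_shift_cylinder[OF V(1) this]
  obtain m where m: "\<forall>y. (\<forall>i. y i \<in> A) \<and> (\<forall>i<m. y i = x i) \<longrightarrow> y \<in> V"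
    by blast
  have \<Phi>0: "\<Phi> y 0 = \<Phi> x 0" if "y \<in> X" "\<And>i. i < m \<Longrightarrow> y i = x i" for y
  proof -
    have "y \<in> ?S" using m that XA V(2) by blast
    then show ?thesis by simp
  qed
  obtain n where n: "n > m" "\<And>i. i < m \<Longrightarrow> f n i = x i"
    using x[of m] by (auto simp: infinite_nat_iff_unbounded)
  have "\<Phi> (f n) 0 = \<Phi> x 0" by (rule \<Phi>0) (simp_all add: fg(1) n(2))
  moreover have "\<Phi> (g n) 0 = \<Phi> x 0"
  proof (rule \<Phi>0)
    fix i assume "i < m"
    then show "g n i = x i" using n fg(3)[of i n] by simp
  qed (rule fg(2))
  ultimately show False using fg(4)[of n] by simp
qed

section \<open>Linear recurrence\<close>

text \<open>Linear recurrence in the form in which it is used: every word of length \<open>n\<close> starts at one of the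
  positions \<open>0, \<dots>, K n\<close> of every point.\<close>

locale lr_shift =
  fixes A :: "'a set" and X :: "(nat \<Rightarrow> 'a) set" and K :: nat
  assumes finite_A: "finite A"
    and X_values: "x \<in> X \<Longrightarrow> x i \<in> A"
    and X_closed: "(\<And>m. \<exists>y\<in>X. \<forall>i<m. y i = x i) \<Longrightarrow> x \<in> X"
    and X_shift: "x \<in> X \<Longrightarrow> left_shift x \<in> X"
    and X_recurrent: "x \<in> X \<Longrightarrow> y \<in> X \<Longrightarrow> \<exists>i\<le>K * n. \<forall>j<n. x (i + j) = y j"
    and X_infinite: "infinite X"
begin

lemma funpow_shift_in: "x \<in> X \<Longrightarrow> (left_shift ^^ n) x \<in> X"
  by (induction n) (auto simp: X_shift)

lemma recurrentE:
  assumes "x \<in> X" "y \<in> X"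
  obtains i where "s \<le> i" "i \<le> s + K * n" "\<And>j. j < n \<Longrightarrow> x (i + j) = y (t + j)"
proof -
  from X_recurrent[OF funpow_shift_in[OF assms(1), of s] funpow_shift_in[OF assms(2), of t], of n]
  obtain i where "i \<le> K * n" "\<forall>j<n. x (s + (i + j)) = y (t + j)"
    by (auto simp: left_shift_funpow)
  then show thesis by (intro that[of "s + i"]) (auto simp: add.assoc)
qed

section \<open>Periods and repeated words\<close>

lemma not_all_periodic:
  assumes "d > 0" and period: "\<And>x i. x \<in> X \<Longrightarrow> x (i + d) = x i"
  shows False
proof -
  have mod: "x i = x (i mod d)" if "x \<in> X" for x i
  proof (induction i rule: less_induct)
    case (less i)
    show ?case
    proof (cases "i < d")
      case False
      then have "x i = x (i - d)" using period[OF that, of "i - d"] by simp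
      also have "\<dots> = x (i mod d)"
        using less[of "i - d"] False \<open>d > 0\<close> by (simp add: le_mod_geq)
      finally show ?thesis .
    qed simp
  qed
  \<comment> \<open>A point of period \<open>d\<close> is determined by its first \<open>d\<close>
    letters, for which there are finitely many choices.\<close>
  have "inj_on (\<lambda>x. map x [0..<d]) X"
  proof (rule inj_onI, rule ext)
    fix x y i assume "x \<in> X" "y \<in> X" "map x [0..<d] = map y [0..<d]"
    then show "x i = y i"
      using mod[of x i] mod[of y i] \<open>d > 0\<close> by (auto simp: map_eq_conv)
  qed
  moreover have "finite ((\<lambda>x. map x [0..<d]) ` X)"
    by (rule finite_subset[OF _ finite_lists_length_eq[OF finite_A, of d]]) (auto simp: X_values)
  ultimately show False using X_infinite finite_imageD by blast
qed

text \<open>Among any \<open>(K + 1) * (d + 1)\<close> consecutive positions every word of length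
  \<open>d + 1\<close> starts somewhere, so a stretch this long with period \<open>d\<close> would
  force the period \<open>d\<close> on all of \<open>X\<close>.\<close>

lemma period_lower_bound:
  assumes "x \<in> X" "d > 0" and period: "\<And>j. j < n \<Longrightarrow> x (i + d + j) = x (i + j)"
  shows "n < (K + 1) * (d + 1)"
proof (rule ccontr)
  assume n: "\<not> ?thesis"
  have "z (s + d) = z s" if z: "z \<in> X" for z s
  proof -
    obtain p where p: "i \<le> p" "p \<le> i + K * (d + 1)" "\<And>j. j < d + 1 \<Longrightarrow> x (p + j) = z (s + j)"
      using recurrentE[OF \<open>x \<in> X\<close> z, of i "d + 1" s] by blast
    have "p - i < n" using n p(2) by simp
    from period[OF this] have "x (p + d) = x p" using p(1) by (simp add: add_ac)
    then show ?thesis using p(3)[of d] p(3)[of 0] by simp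
  qed
  then show False using not_all_periodic[OF \<open>d > 0\<close>] by blast
qed

text \<open>Two occurrences at distance \<open>d\<close> create the period \<open>d\<close>, and the
  period bound then gives \<open>d \<ge> h\<close>. Hence a block of length \<open>h\<close>
  contains at most one start of a given word of length \<open>2 * (K + 1) * h\<close>.\<close>

lemma occurrences_separated:
  assumes "x \<in> X" and "p \<noteq> q" and "h > 0"
    and occ: "\<And>j. j < 2 * (K + 1) * h \<Longrightarrow> x (p + j) = x (q + j)"
  shows "p div h \<noteq> q div h"
proof -
  have *: "p div h \<noteq> q div h"
    if "p < q" and occ: "\<And>j. j < 2 * (K + 1) * h \<Longrightarrow> x (p + j) = x (q + j)" for p q
  proof
    assume eq: "p div h = q div h"
    have "2 * (K + 1) * h < (K + 1) * (q - p + 1)"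
      using period_lower_bound[OF \<open>x \<in> X\<close>, of "q - p" "2 * (K + 1) * h" p] that by simp
    then have "(K + 1) * (2 * h) < (K + 1) * (q - p + 1)" by (simp only: ac_simps)
    then have "2 * h < q - p + 1" by (simp only: mult_less_cancel1)
    then have "h \<le> q - p" by simp
    have "(p + h) div h \<le> q div h"
      by (rule div_le_mono) (use \<open>h \<le> q - p\<close> that(1) in simp)
    then show False using eq \<open>h > 0\<close> by simp
  qed
  show ?thesis
    using *[of p q] *[of q p] assms by (metis linorder_neqE_nat)
qed

text \<open>By compactness, injectivity would let a fixed number of letters determine the letter
  before them. A repeated word would then propagate to the left into a periodic stretch that is too
  long.\<close>

lemma shift_not_injective:
  obtains y y' where "y \<in> X" "y' \<in> X" "y \<noteq> y'" "left_shift y = left_shift y'"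
proof (rule ccontr)
  assume "\<not> thesis"
  with that have "y \<in> X \<Longrightarrow> y' \<in> X \<Longrightarrow> left_shift y = left_shift y' \<Longrightarrow> y = y'" for y y'
    by blast
  then have inj: "y = y'" if "y \<in> X" "y' \<in> X" "\<And>i. y (Suc i) = y' (Suc i)" for y y'
    using that by (simp add: left_shift_def)
  have "\<exists>n. \<forall>y\<in>X. \<forall>y'\<in>X. (\<forall>i<n. y (Suc i) = y' (Suc i)) \<longrightarrow> y 0 = y' 0"
  proof (rule ccontr)
    assume "\<not> ?thesis"
    then have "\<forall>n. \<exists>y y'. y \<in> X \<and> y' \<in> X \<and> (\<forall>i<n. y (Suc i) = y' (Suc i)) \<and> y 0 \<noteq> y' 0"
      by blast
    then obtain f g where fg: "\<And>n. f n \<in> X" "\<And>n. g n \<in> X"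
        "\<And>n i. i < n \<Longrightarrow> f n (Suc i) = g n (Suc i)" "\<And>n. f n 0 \<noteq> g n 0"
      by metis
    \<comment> \<open>Passing to the limit with pairs makes both sequences converge along the same
      indices.\<close>
    obtain x where x: "\<And>m. infinite {n. \<forall>i<m. (f n i, g n i) = x i}"
      using koenig[of "A \<times> A" "\<lambda>n i. (f n i, g n i)"] finite_A X_values fg(1,2) by blast
    have approx: "\<exists>n>m. (\<forall>i<m. f n i = fst (x i)) \<and> (\<forall>i<m. g n i = snd (x i))" for m
    proof -
      obtain n where "n > m" "\<forall>i<m. (f n i, g n i) = x i"
        using x[of m] by (auto simp: infinite_nat_iff_unbounded)
      then show ?thesis by (metis fst_conv snd_conv)
    qed
    have "(\<lambda>i. fst (x i)) \<in> X"
      by (rule X_closed) (metis approx fg(1))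
    moreover have "(\<lambda>i. snd (x i)) \<in> X"
      by (rule X_closed) (metis approx fg(2))
    moreover have "fst (x (Suc i)) = snd (x (Suc i))" for i
    proof -
      obtain n where "n > Suc (Suc i)" "f n (Suc i) = fst (x (Suc i))" "g n (Suc i) = snd (x (Suc i))"
        using approx[of "Suc (Suc i)"] by auto
      then show ?thesis using fg(3)[of i n] by simp
    qed
    ultimately have "fst (x 0) = snd (x 0)"
      by (rule inj[THEN fun_cong])
    moreover have "fst (x 0) \<noteq> snd (x 0)"
      using approx[of "Suc 0"] fg(4) by (metis lessI)
    ultimately show False by simp
  qed
  then obtain n where n: "\<And>y y'. y \<in> X \<Longrightarrow> y' \<in> X \<Longrightarrow> (\<And>i. i < n \<Longrightarrow> y (Suc i) = y' (Suc i)) \<Longrightarrow> y 0 = y' 0"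
    by blast
  obtain x where x: "x \<in> X" using X_infinite by (metis ex_in_conv finite.emptyI)
  \<comment> \<open>With \<open>N > 0\<close>, agreement on \<open>N\<close> letters includes
    agreement at offset 0. The value of \<open>m\<close> is the period bound for the largest
    possible distance \<open>K * N + 1\<close>.\<close>
  define N where "N = Suc n"
  define m where "m = (K + 1) * (K * N + 2)"
  obtain p where p: "m + 1 \<le> p" "p \<le> m + 1 + K * N" "\<And>j. j < N \<Longrightarrow> x (p + j) = x (m + j)"
    using recurrentE[OF x x, of "m + 1" N m] by blast
  define d where "d = p - m"
  have d: "p = m + d" "0 < d" "d \<le> K * N + 1" using p(1,2) by (auto simp: d_def)
  \<comment> \<open>Downward induction from \<open>m\<close> to 0: the \<open>n\<close> letters
    after position \<open>i\<close> determine the letter at \<open>i\<close>.\<close>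
  have per: "\<forall>j<N. x (i + d + j) = x (i + j)" if "i \<le> m" for i
    using that
  proof (induction i rule: inc_induct)
    case base
    then show ?case using p(3) d(1) by simp
  next
    case (step i)
    have "(left_shift ^^ (i + d)) x 0 = (left_shift ^^ i) x 0"
    proof (rule n[OF funpow_shift_in[OF x] funpow_shift_in[OF x]])
      fix j assume "j < n"
      then show "(left_shift ^^ (i + d)) x (Suc j) = (left_shift ^^ i) x (Suc j)"
        using step.IH by (simp add: left_shift_funpow N_def)
    qed
    then have "x (i + d) = x i" by (simp add: left_shift_funpow)
    moreover have "x (i + d + Suc j) = x (i + Suc j)" if "Suc j < N" for j
      using step.IH[rule_format, of j] that by simp
    ultimately show ?case by (metis add.right_neutral not0_implies_Suc)
  qed
  have "x (0 + d + j) = x (0 + j)" if "j < m" for j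
    using per[of j, rule_format, of 0] that by (simp add: N_def add.commute)
  then have "m < (K + 1) * (d + 1)" by (rule period_lower_bound[OF x d(2)])
  also have "\<dots> \<le> m" unfolding m_def using d(3) by (intro mult_le_mono2) simp
  finally show False by simp
qed

section \<open>Branch points and the number of words\<close>

definition branch_points :: "(nat \<Rightarrow> 'a) set" where
  "branch_points = {z. \<exists>y\<in>X. \<exists>y'\<in>X. y \<noteq> y' \<and> left_shift y = z \<and> left_shift y' = z}"

text \<open>By shift invariance, prefixes of points already give every word of the language.\<close>

definition words :: "nat \<Rightarrow> 'a list set" where
  "words n = (\<lambda>x. map x [0..<n]) ` X"

lemma finite_words: "finite (words n)"
  unfolding words_def
  by (rule finite_subset[OF _ finite_lists_length_eq[OF finite_A, of n]]) (auto simp: X_values)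

lemma card_words_le: "card (words n) \<le> K * n + 1"
proof -
  obtain x where x: "x \<in> X" using X_infinite by (metis ex_in_conv finite.emptyI)
  have "words n \<subseteq> (\<lambda>i. map (\<lambda>j. x (i + j)) [0..<n]) ` {..K * n}"
  proof
    fix w assume "w \<in> words n"
    then obtain y where y: "y \<in> X" "w = map y [0..<n]" by (auto simp: words_def)
    from X_recurrent[OF x y(1), of n] obtain i where "i \<le> K * n" "\<forall>j<n. x (i + j) = y j" by blast
    then show "w \<in> (\<lambda>i. map (\<lambda>j. x (i + j)) [0..<n]) ` {..K * n}"
      by (intro image_eqI[of _ _ i]) (auto simp: y(2))
  qed
  then have "card (words n) \<le> card {..K * n}" by (rule surj_card_le[rotated]) simp
  then show ?thesis by simp
qed

text \<open>Deleting the first letter maps \<open>words (Suc n)\<close> onto \<open>words n\<close>,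
  and the prefix of a branch point has at least two preimages. \<open>g\<close> selects one preimage
  of each word, \<open>h\<close> a further one for each element of \<open>F\<close>.\<close>

lemma card_words_Suc:
  assumes "finite F" "F \<subseteq> branch_points" and inj: "inj_on (\<lambda>x. map x [0..<n]) F"
  shows "card (words n) + card F \<le> card (words (Suc n))"
proof -
  have "\<exists>v. v \<in> words (Suc n) \<and> tl v = w" if "w \<in> words n" for w
  proof -
    from that obtain x where x: "x \<in> X" "w = map x [0..<n]" by (auto simp: words_def)
    \<comment> \<open>A prefix recurs at a positive position, where a letter precedes it.\<close>
    obtain i where i: "1 \<le> i" "\<And>j. j < n \<Longrightarrow> x (i + j) = x (0 + j)"
      using recurrentE[OF x(1) x(1), of 1 n 0] by blast
    have "tl (map ((left_shift ^^ (i - 1)) x) [0..<Suc n]) = w"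
      using i by (auto simp: x(2) map_upt_Suc left_shift_funpow simp del: upt_Suc)
    then show ?thesis using funpow_shift_in[OF x(1)] unfolding words_def by blast
  qed
  then obtain g where g: "\<And>w. w \<in> words n \<Longrightarrow> g w \<in> words (Suc n) \<and> tl (g w) = w" by metis
  have "\<exists>v. v \<in> words (Suc n) \<and> tl v = map z [0..<n] \<and> v \<noteq> g (map z [0..<n])" if "z \<in> F" for z
  proof -
    from that assms(2) obtain y y' where y: "y \<in> X" "y' \<in> X" "y \<noteq> y'"
        "left_shift y = z" "left_shift y' = z" by (auto simp: branch_points_def)
    have z: "y (Suc i) = z i" "y' (Suc i) = z i" for i
      using fun_cong[OF y(4), of i] fun_cong[OF y(5), of i] by (simp_all add: left_shift_def)
    have "y 0 \<noteq> y' 0"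
    proof
      assume "y 0 = y' 0"
      then have "y i = y' i" for i by (cases i) (simp_all add: z)
      with y(3) show False by blast
    qed
    then have "map y [0..<Suc n] \<noteq> map y' [0..<Suc n]"
      by (simp add: map_upt_Suc del: upt_Suc)
    moreover have "tl (map y [0..<Suc n]) = map z [0..<n]" "tl (map y' [0..<Suc n]) = map z [0..<n]"
      by (simp_all add: map_upt_Suc z del: upt_Suc)
    ultimately show ?thesis using y(1,2) unfolding words_def by (metis image_eqI)
  qed
  then obtain h where h: "\<And>z. z \<in> F \<Longrightarrow> h z \<in> words (Suc n) \<and> tl (h z) = map z [0..<n] \<and>
      h z \<noteq> g (map z [0..<n])" by metis
  have "inj_on g (words n)" by (rule inj_on_inverseI[of _ tl]) (use g in auto)
  moreover have "inj_on h F"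
    by (rule inj_onI) (use h inj in \<open>metis inj_on_def\<close>)
  moreover have "g ` words n \<inter> h ` F = {}" using g h by force
  ultimately have "card (words n) + card F = card (g ` words n \<union> h ` F)"
    using assms(1) finite_words by (simp add: card_Un_disjoint card_image)
  also have "\<dots> \<le> card (words (Suc n))"
    using g h by (intro card_mono finite_words) auto
  finally show ?thesis .
qed

text \<open>With more than \<open>K\<close> branch points the number of words would eventually grow
  by at least \<open>K + 1\<close> per unit of length, against the linear bound.\<close>

lemma card_finite_branch_points_le:
  assumes "finite F" "F \<subseteq> branch_points"
  shows "card F \<le> K"
proof (rule ccontr)
  assume large: "\<not> card F \<le> K"
  let ?D = "\<lambda>(x, y). LEAST i. x i \<noteq> (y i :: 'a)"
  \<comment> \<open>Beyond the largest first index of disagreement, prefixes separate the points of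
    \<open>F\<close>.\<close>
  have "finite (?D ` (F \<times> F))" using assms(1) by simp
  then obtain N where N: "\<And>x y. x \<in> F \<Longrightarrow> y \<in> F \<Longrightarrow> ?D (x, y) < N"
    by (auto simp: finite_nat_set_iff_bounded)
  have inj: "inj_on (\<lambda>x. map x [0..<N + t]) F" for t
  proof (rule inj_onI, rule ccontr)
    fix x y assume xy: "x \<in> F" "y \<in> F" "map x [0..<N + t] = map y [0..<N + t]" "x \<noteq> y"
    from xy(4) obtain i where "x i \<noteq> y i" by blast
    then have "x (?D (x, y)) \<noteq> y (?D (x, y))" by (simp add: LeastI[of "\<lambda>i. x i \<noteq> y i"])
    moreover have "x i = y i" if "i < N" for i using xy(3) that by simp
    ultimately show False using N[OF xy(1,2)] by blast
  qed
  have grow: "t * card F \<le> card (words (N + t))" for t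
  proof (induction t)
    case (Suc t)
    then show ?case using card_words_Suc[OF assms inj[of t]] by simp
  qed simp
  \<comment> \<open>The two bounds on the number of words of length \<open>N + t\<close> allow only
    \<open>t \<le> K * N + 1\<close>.\<close>
  define t where "t = K * N + 2"
  have "t * (K + 1) \<le> t * card F" using large by (intro mult_le_mono2) simp
  also have "\<dots> \<le> K * (N + t) + 1" using grow[of t] card_words_le[of "N + t"] by simp
  finally have "t \<le> K * N + 1" by (simp add: algebra_simps)
  then show False by (simp add: t_def)
qed

lemma finite_branch_points: "finite branch_points"
  and card_branch_points_le: "card branch_points \<le> K"
  using finite_if_finite_subsets_card_bdd[of branch_points K] card_finite_branch_points_le by blast+

text \<open>One step before their shifts first coincide the two points still differ, so the common
  shift has two preimages.\<close>

lemma merging_reaches_branch_point: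
  assumes "x \<in> X" "x' \<in> X" "x \<noteq> x'" and merge: "\<And>i. n \<le> i \<Longrightarrow> x i = x' i"
  obtains j where "(left_shift ^^ j) x \<in> branch_points"
proof -
  let ?P = "\<lambda>n. (left_shift ^^ n) x = (left_shift ^^ n) x'"
  have "?P n" using merge by (intro left_shift_funpow_eqI) simp
  then have P: "?P (LEAST n. ?P n)" by (rule LeastI)
  with assms(3) obtain m where m: "(LEAST n. ?P n) = Suc m"
    by (cases "LEAST n. ?P n") auto
  then have "\<not> ?P m" using not_less_Least[of m ?P] by simp
  with P have "(left_shift ^^ Suc m) x \<in> branch_points"
    unfolding m branch_points_def using funpow_shift_in assms(1,2) by auto
  then show thesis by (rule that)
qed

end

section \<open>Endomorphisms\<close>

locale lr_endomorphism = lr_shift +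
  fixes \<Phi> :: "(nat \<Rightarrow> 'a) \<Rightarrow> (nat \<Rightarrow> 'a)" and r :: nat
  assumes \<Phi>_in: "x \<in> X \<Longrightarrow> \<Phi> x \<in> X"
    and \<Phi>_surj: "y \<in> X \<Longrightarrow> \<exists>x\<in>X. \<Phi> x = y"
    and \<Phi>_shift: "x \<in> X \<Longrightarrow> \<Phi> (left_shift x) = left_shift (\<Phi> x)"
    and \<Phi>_local: "x \<in> X \<Longrightarrow> y \<in> X \<Longrightarrow> (\<And>i. i < r \<Longrightarrow> x i = y i) \<Longrightarrow> \<Phi> x 0 = \<Phi> y 0"
begin

section \<open>Iterates of the endomorphism\<close>

lemma funpow_in: "x \<in> X \<Longrightarrow> (\<Phi> ^^ a) x \<in> X"
  by (induction a) (auto simp: \<Phi>_in)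

lemma funpow_surj: "y \<in> X \<Longrightarrow> \<exists>x\<in>X. (\<Phi> ^^ a) x = y"
proof (induction a arbitrary: y)
  case (Suc a)
  from \<Phi>_surj[OF Suc.prems] obtain z where "z \<in> X" "\<Phi> z = y" by blast
  with Suc.IH[of z] show ?case by auto
qed auto

lemma \<Phi>_funpow_shift: "x \<in> X \<Longrightarrow> \<Phi> ((left_shift ^^ n) x) = (left_shift ^^ n) (\<Phi> x)"
  by (induction n) (auto simp: \<Phi>_shift funpow_shift_in)

lemma funpow_funpow_shift:
  "x \<in> X \<Longrightarrow> (\<Phi> ^^ a) ((left_shift ^^ n) x) = (left_shift ^^ n) ((\<Phi> ^^ a) x)"
  by (induction a) (auto simp: \<Phi>_funpow_shift funpow_in)

text \<open>Each application of \<open>\<Phi>\<close> costs \<open>r\<close> letters on the right.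
  The offsets \<open>s\<close> and \<open>t\<close> permit comparison of occurrences at different
  positions.\<close>

lemma funpow_local:
  assumes "x \<in> X" "y \<in> X" and "\<And>i. i < n + r * a \<Longrightarrow> x (s + i) = y (t + i)" and "i < n"
  shows "(\<Phi> ^^ a) x (s + i) = (\<Phi> ^^ a) y (t + i)"
  using assms(3,4)
proof (induction a arbitrary: n i)
  case (Suc a)
  have eq: "(\<Phi> ^^ a) x (s + j) = (\<Phi> ^^ a) y (t + j)" if "j < n + r" for j
    by (rule Suc.IH[of "n + r", OF Suc.prems(1) that]) (simp add: add_ac)
  let ?x = "(left_shift ^^ (s + i)) ((\<Phi> ^^ a) x)" and ?y = "(left_shift ^^ (t + i)) ((\<Phi> ^^ a) y)"
  have "\<Phi> ?x 0 = \<Phi> ?y 0"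
  proof (rule \<Phi>_local)
    fix j assume "j < r"
    then show "?x j = ?y j" using eq[of "i + j"] Suc.prems(2) by (simp add: left_shift_funpow add_ac)
  qed (auto simp: funpow_shift_in funpow_in assms)
  then show ?case
    by (simp add: \<Phi>_funpow_shift funpow_in assms left_shift_funpow)
qed simp

text \<open>Fix a word \<open>u\<close> of length \<open>N\<close> and let \<open>\<Gamma> a\<close> be the set of pairs of words of length \<open>(K + 2) N\<close>
  at the start of two points with the same image under \<open>\<Phi>\<^sup>a\<close>, the first point starting with \<open>u\<close>.
  These sets increase with \<open>a\<close>, while occurrences being well separated bounds their size independently
  of \<open>a\<close> and \<open>N\<close>. So \<open>\<Gamma> a = \<Gamma> (a + 1)\<close> for some \<open>a\<close>, and as \<open>u\<close> recurs with gaps at most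
  \<open>K N\<close>, two points with the same image under \<open>\<Phi>\<^bsup>a + 1\<^esup>\<close> eventually have the same image
  under \<open>\<Phi>\<^sup>a\<close>.\<close>

lemma eventually_injective:
  assumes "y \<in> X" "y' \<in> X" "\<Phi> y = \<Phi> y'"
  obtains n where "\<And>i. n \<le> i \<Longrightarrow> y i = y' i"
proof -
  \<comment> \<open>There is no circularity: \<open>c\<close> depends on \<open>K\<close> alone, and
    \<open>K * L = (c - 1) * h\<close>, so \<open>c\<close> blocks of length \<open>h\<close>
    contain a start of every word of length \<open>L\<close>. Thus \<open>M\<close> counts pairs of
    blocks, and \<open>h\<close> exceeds the loss \<open>r * a\<close> for all
    \<open>a \<le> M + 1\<close>.\<close>
  define c where "c = K * (2 * (K + 1) * (K + 2)) + 1"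
  define M where "M = c * c"
  define h where "h = r * (M + 1) + 1"
  define N where "N = 2 * (K + 1) * h"
  define L where "L = (K + 2) * N"
  define word :: "(nat \<Rightarrow> 'a) \<Rightarrow> 'a list" where "word = (\<lambda>x. map x [0..<L])"
  define x0 where "x0 = y"
  have x0: "x0 \<in> X" using assms(1) by (simp add: x0_def)
  define \<Gamma> where "\<Gamma> = (\<lambda>a. {(word x, word x') | x x'. x \<in> X \<and> x' \<in> X \<and>
      (\<Phi> ^^ a) x = (\<Phi> ^^ a) x' \<and> (\<forall>j<N. x j = x0 j)})"
  have "h > 0" by (simp add: h_def)
  have "h \<le> N" by (simp add: N_def)
  have ra: "r * a < N" if "a \<le> M + 1" for a
    using mult_le_mono2[OF that, of r] \<open>h \<le> N\<close> by (simp add: h_def)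
  have L: "L = K * N + N + N" by (simp add: L_def algebra_simps)
  have word_eq: "word x = word x' \<longleftrightarrow> (\<forall>i<L. x i = x' i)" for x x'
    by (auto simp: word_def map_eq_conv)
  have "\<exists>p<c * h. \<forall>j<L. x0 (p + j) = w ! j" if w: "w \<in> word ` X" for w
  proof -
    from w obtain x where x: "x \<in> X" "w = word x" by blast
    obtain p where p: "p \<le> K * L" "\<forall>j<L. x0 (p + j) = x j"
      using X_recurrent[OF x0 x(1)] by blast
    have "K * L = (c - 1) * h" by (simp add: L_def N_def c_def algebra_simps)
    also have "\<dots> < c * h" using \<open>h > 0\<close> by (simp add: c_def)
    finally show ?thesis using p by (intro exI[of _ p]) (auto simp: x(2) word_def)
  qed
  then obtain pos where pos_word: "\<And>w. w \<in> word ` X \<Longrightarrow> pos w < c * h \<and> (\<forall>j<L. x0 (pos w + j) = w ! j)"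
    by metis
  have nth_word: "word x ! j = x j" if "j < L" for x j
    using that by (simp add: word_def)
  have pos: "pos (word x) < c * h" "\<And>j. j < L \<Longrightarrow> x0 (pos (word x) + j) = x j"
    if "x \<in> X" for x
    using pos_word[of "word x"] that nth_word by auto
  \<comment> \<open>\<open>pos\<close> locates each word inside the single point \<open>x0\<close>;
    only the blocks of the two positions are recorded.\<close>
  define \<pi> where "\<pi> = (\<lambda>(v, w). (pos v div h, pos w div h))"
  have inj: "inj_on \<pi> (\<Gamma> a)" if a: "a \<le> M + 1" for a
  proof (rule inj_onI)
    fix P Q assume "P \<in> \<Gamma> a" "Q \<in> \<Gamma> a" and eq: "\<pi> P = \<pi> Q"
    then obtain x x' z z' where xz: "P = (word x, word x')" "Q = (word z, word z')"
      "x \<in> X" "x' \<in> X" "z \<in> X" "z' \<in> X" "(\<Phi> ^^ a) x = (\<Phi> ^^ a) x'" "(\<Phi> ^^ a) z = (\<Phi> ^^ a) z'"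
      "\<And>j. j < N \<Longrightarrow> x j = x0 j" "\<And>j. j < N \<Longrightarrow> z j = x0 j"
      by (auto simp: \<Gamma>_def)
    \<comment> \<open>Both first components start with the same word of length \<open>N\<close>, so
      occurrences in the same block coincide.\<close>
    have "x0 (pos (word x) + j) = x0 (pos (word z) + j)" if "j < N" for j
      using pos(2)[OF xz(3), of j] pos(2)[OF xz(5), of j] xz(9,10)[OF that] that L by simp
    from occurrences_separated[OF x0 _ \<open>h > 0\<close> this[unfolded N_def]]
    have "pos (word x) = pos (word z)"
      using eq by (auto simp: \<pi>_def xz(1,2))
    then have xz_eq: "x i = z i" if "i < L" for i
      using pos(2)[OF xz(3) that] pos(2)[OF xz(5) that] by simp
    have image: "(\<Phi> ^^ a) x0 (pos (word v) + j) = (\<Phi> ^^ a) v j" if "v \<in> X" "j < N" for v j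
      using funpow_local[OF x0 that(1), of N a "pos (word v)" 0 j] pos(2)[OF that(1)] that(2) ra[OF a] L
      by simp
    \<comment> \<open>Now the images of \<open>x'\<close> and \<open>z'\<close> share
      \<open>N\<close> letters too, and separation is applied once more, in the image of
      \<open>x0\<close>.\<close>
    have "(\<Phi> ^^ a) x j = (\<Phi> ^^ a) z j" if "j < N" for j
      using funpow_local[OF xz(3,5), of N a 0 0 j] xz_eq that ra[OF a] L by simp
    then have "(\<Phi> ^^ a) x0 (pos (word x') + j) = (\<Phi> ^^ a) x0 (pos (word z') + j)" if "j < N" for j
      using image[OF xz(4) that] image[OF xz(6) that] xz(7,8) that by simp
    from occurrences_separated[OF funpow_in[OF x0] _ \<open>h > 0\<close> this[unfolded N_def]]
    have "pos (word x') = pos (word z')"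
      using eq by (auto simp: \<pi>_def xz(1,2))
    then have "x' i = z' i" if "i < L" for i
      using pos(2)[OF xz(4) that] pos(2)[OF xz(6) that] by simp
    then show "P = Q" using xz_eq by (simp add: xz(1,2) word_eq)
  qed
  have range: "\<pi> ` \<Gamma> a \<subseteq> {..<c} \<times> {..<c}" for a
    using pos(1) by (auto simp: \<Gamma>_def \<pi>_def less_mult_imp_div_less)
  have card: "finite (\<Gamma> a)" "card (\<Gamma> a) \<le> M" if "a \<le> M + 1" for a
    using inj_on_finite[OF inj[OF that] range] card_inj_on_le[OF inj[OF that] range]
    by (simp_all add: M_def)
  have mono: "\<Gamma> a \<subseteq> \<Gamma> (Suc a)" for a
    by (force simp: \<Gamma>_def)
  have "\<exists>a\<le>M. \<Gamma> a = \<Gamma> (Suc a)"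
  proof (rule ccontr)
    assume "\<not> ?thesis"
    then have strict: "\<Gamma> a \<subset> \<Gamma> (Suc a)" if "a \<le> M" for a using mono that by blast
    have "a \<le> M + 1 \<Longrightarrow> a \<le> card (\<Gamma> a)" for a
    proof (induction a)
      case (Suc a)
      then show ?case using psubset_card_mono[OF card(1) strict[of a]] by simp
    qed simp
    from this[of "M + 1"] card(2)[of "M + 1"] show False by simp
  qed
  then obtain a where a: "a \<le> M" "\<Gamma> (Suc a) = \<Gamma> a" by metis
  obtain x x' where x: "x \<in> X" "x' \<in> X" "(\<Phi> ^^ a) x = y" "(\<Phi> ^^ a) x' = y'"
    using funpow_surj assms(1,2) by metis
  show thesis
  proof (rule that[of "K * N"])
    fix i assume "K * N \<le> i"
    \<comment> \<open>The fixed word starts in \<open>x\<close> at most \<open>K * N\<close>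
      positions before \<open>i\<close>.\<close>
    obtain n where n: "i - K * N \<le> n" "n \<le> i - K * N + K * N" "\<And>j. j < N \<Longrightarrow> x (n + j) = x0 (0 + j)"
      using recurrentE[OF x(1) x0, of "i - K * N" N 0] by blast
    define t where "t = i - n"
    have t: "i = n + t" "t \<le> K * N" using n(1,2) \<open>K * N \<le> i\<close> by (auto simp: t_def)
    define z z' where "z = (left_shift ^^ n) x" and "z' = (left_shift ^^ n) x'"
    have z: "z \<in> X" "z' \<in> X" by (simp_all add: z_def z'_def funpow_shift_in x)
    have "\<forall>j<N. z j = x0 j" using n(3) by (simp add: z_def left_shift_funpow)
    moreover have "(\<Phi> ^^ Suc a) z = (\<Phi> ^^ Suc a) z'"
      using x assms(3) by (simp add: z_def z'_def funpow_funpow_shift \<Phi>_funpow_shift assms)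
    ultimately have "(word z, word z') \<in> \<Gamma> (Suc a)"
      using z unfolding \<Gamma>_def by blast
    then obtain v v' where v: "v \<in> X" "v' \<in> X" "(\<Phi> ^^ a) v = (\<Phi> ^^ a) v'"
      "word z = word v" "word z' = word v'"
      unfolding a(2) by (auto simp: \<Gamma>_def)
    \<comment> \<open>The words of length \<open>L\<close> are long enough to determine coordinate
      \<open>t\<close> after \<open>a\<close> applications of \<open>\<Phi>\<close>, and there
      \<open>v\<close> and \<open>v'\<close> have equal images.\<close>
    have "Suc t + r * a \<le> L" using t(2) ra[of a] a(1) L by simp
    then have "(\<Phi> ^^ a) z t = (\<Phi> ^^ a) v t" "(\<Phi> ^^ a) z' t = (\<Phi> ^^ a) v' t"
      using funpow_local[OF z(1) v(1), of "Suc t" a 0 0 t] funpow_local[OF z(2) v(2), of "Suc t" a 0 0 t]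
        v(4,5) by (simp_all add: word_eq)
    then show "y i = y' i"
      using v(3) x by (simp add: z_def z'_def funpow_funpow_shift left_shift_funpow t(1))
  qed
qed

text \<open>Long prefixes of \<open>w\<close> recur in \<open>x\<close> far to the right, where the
  relation can be read off. With truncated subtraction, at least one of \<open>p - q\<close> and
  \<open>q - p\<close> is 0.\<close>

lemma funpow_eq_shift_extend:
  assumes "x \<in> X" "w \<in> X" and eq: "(\<Phi> ^^ k) ((left_shift ^^ p) x) = (left_shift ^^ q) x"
  shows "(\<Phi> ^^ k) w (p - q + i) = w (q - p + i)"
proof -
  obtain n where n: "p + q \<le> n" "\<And>j. j < Suc (p + q + i) + r * k \<Longrightarrow> x (n + j) = w (0 + j)"
    using recurrentE[OF assms(1,2), of "p + q" "Suc (p + q + i) + r * k" 0] by blast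
  \<comment> \<open>Subtracting \<open>min p q\<close> aligns both sides at the same coordinate
    \<open>e\<close>; \<open>p + q \<le> n\<close> prevents truncation.\<close>
  define e where "e = n - min p q + i"
  have e: "n + (p - q + i) = p + e" "n + (q - p + i) = q + e" using n(1) by (auto simp: e_def min_def)
  have "(\<Phi> ^^ k) w (p - q + i) = (\<Phi> ^^ k) x (n + (p - q + i))"
    using funpow_local[OF assms(1,2), of "Suc (p + q + i)" k n 0 "p - q + i"] n(2) by simp
  also have "\<dots> = (left_shift ^^ p) ((\<Phi> ^^ k) x) e" by (simp add: e left_shift_funpow)
  also have "\<dots> = (left_shift ^^ q) x e" using eq by (simp add: funpow_funpow_shift assms(1))
  also have "\<dots> = x (n + (q - p + i))" by (simp add: e left_shift_funpow)
  also have "\<dots> = w (q - p + i)" using n(2)[of "q - p + i"] by simp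
  finally show ?thesis .
qed

text \<open>For \<open>p > q\<close> the relation would give \<open>\<Phi>^k\<close> composed with a
  positive power of the shift as the identity, making the shift injective.\<close>

lemma funpow_eq_funpow_shift:
  assumes "x \<in> X" and eq: "(\<Phi> ^^ k) ((left_shift ^^ p) x) = (left_shift ^^ q) x"
  shows "\<exists>n. \<forall>w\<in>X. (\<Phi> ^^ k) w = (left_shift ^^ n) w"
proof (cases "p \<le> q")
  case True
  then have "(\<Phi> ^^ k) w = (left_shift ^^ (q - p)) w" if "w \<in> X" for w
    using funpow_eq_shift_extend[OF assms(1) that eq] by (auto simp: left_shift_funpow)
  then show ?thesis by blast
next
  case False
  obtain y y' where y: "y \<in> X" "y' \<in> X" "y \<noteq> y'" "left_shift y = left_shift y'"
    by (rule shift_not_injective)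
  from False obtain m where m: "p - q = Suc m" by (cases "p - q") auto
  have inverse: "w = (\<Phi> ^^ k) ((left_shift ^^ m) (left_shift w))" if "w \<in> X" for w
  proof
    fix i
    have "(\<Phi> ^^ k) ((left_shift ^^ m) (left_shift w)) = (left_shift ^^ Suc m) ((\<Phi> ^^ k) w)"
      using funpow_funpow_shift[OF that, of k "Suc m"] by (simp add: funpow_swap1)
    then show "w i = (\<Phi> ^^ k) ((left_shift ^^ m) (left_shift w)) i"
      using funpow_eq_shift_extend[OF assms(1) that eq, of i] False m
      by (simp add: left_shift_funpow del: funpow.simps)
  qed
  then have "y = y'" using y by metis
  with y(3) show ?thesis by blast
qed

lemma backward_orbit:
  assumes "y \<in> X"
  obtains f where "f 0 = y" "\<And>i. f i \<in> X" "\<And>i. \<Phi> (f (Suc i)) = f i"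
proof -
  have "\<exists>f. \<forall>i. (f i \<in> X \<and> (i = 0 \<longrightarrow> f i = y)) \<and> \<Phi> (f (Suc i)) = f i"
    by (rule dependent_nat_choice) (use assms \<Phi>_surj in auto)
  then show thesis using that by blast
qed

lemma root_of_shift: "\<exists>k n. 1 \<le> k \<and> k \<le> K \<and> (\<forall>x\<in>X. (\<Phi> ^^ k) x = (left_shift ^^ n) x)"
proof -
  obtain y y' where y: "y \<in> X" "y' \<in> X" "y \<noteq> y'" "left_shift y = left_shift y'"
    by (rule shift_not_injective)
  obtain f where f: "f 0 = y" "\<And>i. f i \<in> X" "\<And>i. \<Phi> (f (Suc i)) = f i"
    using backward_orbit[OF y(1)] by blast
  obtain f' where f': "f' 0 = y'" "\<And>i. f' i \<in> X" "\<And>i. \<Phi> (f' (Suc i)) = f' i"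
    using backward_orbit[OF y(2)] by blast
  have "f i \<noteq> f' i" for i
    by (induction i) (use f f' y(3) in metis)+
  moreover have "\<exists>n. \<forall>j\<ge>n. f i j = f' i j" for i
  proof (induction i)
    case 0
    have "\<forall>j\<ge>1. y j = y' j"
      using y(4) by (auto simp: left_shift_def fun_eq_iff Suc_le_eq gr0_conv_Suc)
    then show ?case unfolding f(1) f'(1) by blast
  next
    case (Suc i)
    then obtain n where "\<forall>j\<ge>n. f i j = f' i j" by blast
    \<comment> \<open>Once the tails at stage \<open>i\<close> coincide, the shifted points at stage
      \<open>i + 1\<close> have the same image, and eventual injectivity applies.\<close>
    then have "(left_shift ^^ n) (f i) = (left_shift ^^ n) (f' i)"
      by (intro left_shift_funpow_eqI) simp
    then have "\<Phi> ((left_shift ^^ n) (f (Suc i))) = \<Phi> ((left_shift ^^ n) (f' (Suc i)))"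
      by (simp add: \<Phi>_funpow_shift f f')
    then obtain m where m: "\<And>j. m \<le> j \<Longrightarrow> (left_shift ^^ n) (f (Suc i)) j = (left_shift ^^ n) (f' (Suc i)) j"
      using eventually_injective[of "(left_shift ^^ n) (f (Suc i))" "(left_shift ^^ n) (f' (Suc i))"]
        funpow_shift_in f(2) f'(2) by blast
    have "f (Suc i) j = f' (Suc i) j" if "j \<ge> n + m" for j
      using m[of "j - n"] that by (simp add: left_shift_funpow)
    then show ?case by blast
  qed
  ultimately have "\<exists>j. (left_shift ^^ j) (f i) \<in> branch_points" for i
    using merging_reaches_branch_point[of "f i" "f' i"] f(2) f'(2) by metis
  then obtain J where J: "\<And>i. (left_shift ^^ J i) (f i) \<in> branch_points" by metis
  \<comment> \<open>The \<open>K + 1\<close> stages \<open>0, ..., K\<close> meet at most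
    \<open>K\<close> branch points.\<close>
  have "\<not> inj_on (\<lambda>i. (left_shift ^^ J i) (f i)) {..K}"
  proof
    assume "inj_on (\<lambda>i. (left_shift ^^ J i) (f i)) {..K}"
    from card_inj_on_le[OF this _ finite_branch_points] J card_branch_points_le
    show False by force
  qed
  then obtain a b where ab: "a < b" "b \<le> K" "(left_shift ^^ J a) (f a) = (left_shift ^^ J b) (f b)"
    unfolding inj_on_def by (metis atMost_iff linorder_neqE_nat)
  have iterate: "(\<Phi> ^^ k) (f (a + k)) = f a" for k
    by (induction k) (simp_all add: funpow_swap1 f)
  have "(\<Phi> ^^ (b - a)) ((left_shift ^^ J a) (f b)) = (left_shift ^^ J b) (f b)"
    using iterate[of "b - a"] ab by (simp add: funpow_funpow_shift f)
  from funpow_eq_funpow_shift[OF f(2) this]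
  obtain n where "\<forall>x\<in>X. (\<Phi> ^^ (b - a)) x = (left_shift ^^ n) x" by blast
  moreover have "1 \<le> b - a" "b - a \<le> K" using ab by auto
  ultimately show ?thesis by blast
qed

end

section \<open>Return words\<close>

lemma prefix_iff_nth: "prefix u v \<longleftrightarrow> length u \<le> length v \<and> (\<forall>j<length u. u ! j = v ! j)"
proof
  assume "prefix u v"
  then show "length u \<le> length v \<and> (\<forall>j<length u. u ! j = v ! j)"
    by (auto simp: prefix_def nth_append)
next
  assume "length u \<le> length v \<and> (\<forall>j<length u. u ! j = v ! j)"
  then have "u = take (length u) v" by (intro nth_equalityI) auto
  then show "prefix u v" by (metis take_is_prefix)
qed

text \<open>The stretch between consecutive occurrences of \<open>u\<close> is a return word;
  \<open>i + n \<le> i'\<close> makes \<open>u\<close> a prefix of it, as \<open>return_word\<close>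
  demands.\<close>

lemma return_gap_le:
  assumes "recurrence_constant X K" "x \<in> X" "0 < n" "i + n \<le> i'"
    and occ: "\<And>j. j < n \<Longrightarrow> x (i' + j) = x (i + j)"
    and first: "\<And>p. i < p \<Longrightarrow> p < i' \<Longrightarrow> \<exists>j<n. x (p + j) \<noteq> x (i + j)"
  shows "real (i' - i) \<le> K * real n"
proof -
  define u w where "u = map x [i..<i + n]" and "w = map x [i..<i']"
  have u: "u = map x [i'..<i' + n]"
    using occ by (intro nth_equalityI) (auto simp: u_def)
  have wu: "w @ u = map x [i..<i' + n]"
    unfolding u w_def using assms(4) upt_add_eq_append[of i i' n] by simp
  have lang: "map x [a..<b] \<in> language X" for a b
    using assms(2) by (auto simp: language_def)
  have "k \<in> occurrences u (w @ u) \<longleftrightarrow> k = 0 \<or> k = i' - i" for k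
  proof -
    have "k \<in> occurrences u (w @ u) \<longleftrightarrow> i + k \<le> i' \<and> (\<forall>j<n. x (i + j) = x (i + k + j))"
      unfolding wu using assms(3,4) by (auto simp: occurrences_def prefix_iff_nth u_def add_ac)
    also have "\<dots> \<longleftrightarrow> k = 0 \<or> k = i' - i"
    proof (intro iffI)
      assume *: "i + k \<le> i' \<and> (\<forall>j<n. x (i + j) = x (i + k + j))"
      then have "\<not> (i < i + k \<and> i + k < i')" using first[of "i + k"] by metis
      with * show "k = 0 \<or> k = i' - i" by auto
    next
      assume "k = 0 \<or> k = i' - i"
      then show "i + k \<le> i' \<and> (\<forall>j<n. x (i + j) = x (i + k + j))" using occ assms(4) by auto
    qed
    finally show ?thesis .
  qed
  then have "occurrences u (w @ u) = {0, i' - i}" by blast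
  then have "card (occurrences u (w @ u)) = 2" using assms(3,4) by simp
  moreover have "prefix u w" using assms(4) by (auto simp: prefix_iff_nth u_def w_def)
  ultimately have "return_word X u w"
    using lang wu assms(3) by (simp add: return_word_def) (simp add: u_def w_def)
  then have "real (length w) \<le> K * real (length u)"
    using assms(1) by (auto simp: recurrence_constant_def return_word_def)
  then show ?thesis by (simp add: u_def w_def)
qed

lemma minimal_shift_funpow_in:
  assumes "minimal_shift A X" "x \<in> X"
  shows "(left_shift ^^ n) x \<in> X"
  using assms by (induction n) (auto simp: minimal_shift_def one_sided_shift_def)

lemma minimal_shift_recur:
  assumes "minimal_shift A X" "x \<in> X" "y \<in> X"
  obtains p where "s \<le> p" "\<And>j. j < n \<Longrightarrow> x (p + j) = y j"
proof -
  obtain q where "\<And>j. j < n \<Longrightarrow> (left_shift ^^ s) x (q + j) = y j"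
    using minimal_shift_dense[OF assms(1) minimal_shift_funpow_in[OF assms(1,2)] assms(3)] by blast
  then show thesis by (intro that[of "s + q"]) (simp_all add: left_shift_funpow add_ac)
qed

text \<open>The gap between two consecutive occurrences of a single letter is at least 1 and at most
  \<open>K\<close>.\<close>

lemma recurrence_constant_ge_1:
  assumes "minimal_shift A X" "recurrence_constant X K" "x \<in> X"
  shows "1 \<le> K"
proof -
  let ?P = "\<lambda>p. 1 \<le> p \<and> x p = x 0"
  obtain q where "1 \<le> q" "\<And>j. j < 1 \<Longrightarrow> x (q + j) = x j"
    using minimal_shift_recur[OF assms(1,3,3), of 1 1] by blast
  then have "?P q" by (metis add.right_neutral zero_less_one)
  define p where "p = (LEAST p. ?P p)"
  have p: "?P p" unfolding p_def using \<open>?P q\<close> by (rule LeastI)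
  have "real (p - 0) \<le> K * real 1"
    by (rule return_gap_le[OF assms(2,3)]) (use p not_less_Least[of _ ?P] in \<open>auto simp: p_def\<close>)
  with p show ?thesis by simp
qed

text \<open>The first occurrence \<open>i\<close> has no predecessor to measure a gap from. So the
  prefix of \<open>x\<close> up to that occurrence is repeated at some \<open>p > i\<close>: the
  last occurrence \<open>k\<close> before \<open>p + i\<close> lies before \<open>p\<close>, and the
  gap \<open>p + i - k\<close> exceeds \<open>i\<close>.\<close>

lemma linear_recurrence:
  assumes min: "minimal_shift A X" and K: "recurrence_constant X K" and x: "x \<in> X" and y: "y \<in> X"
  shows "\<exists>i\<le>nat \<lceil>K\<rceil> * n. \<forall>j<n. x (i + j) = y j"
proof (cases "n = 0")
  case False
  let ?occ = "\<lambda>p. \<forall>j<n. x (p + j) = y j"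
  obtain q where "?occ q" using minimal_shift_recur[OF min x y, of 0 n] by blast
  define i where "i = (LEAST p. ?occ p)"
  have i: "?occ i" unfolding i_def using \<open>?occ q\<close> by (rule LeastI)
  obtain p where p: "Suc i \<le> p" "\<And>j. j < i + n \<Longrightarrow> x (p + j) = x j"
    using minimal_shift_recur[OF min x x, of "Suc i" "i + n"] by blast
  have occ_p: "?occ (p + j) \<longleftrightarrow> ?occ j" if "j \<le> i" for j
    using p(2)[of "j + _"] that by (simp add: add_ac)
  let ?S = "{k. k < p + i \<and> ?occ k}"
  have S: "finite ?S" "i \<in> ?S" using i p(1) by simp_all
  define k where "k = Max ?S"
  have "k \<in> ?S" unfolding k_def by (rule Max_in) (use S in blast)+
  then have k: "k < p + i" "?occ k" by simp_all
  have max: "m \<le> k" if "m < p + i" "?occ m" for m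
    unfolding k_def by (rule Max_ge[OF S(1)]) (use that in simp)
  have "k < p"
  proof (rule ccontr)
    assume "\<not> k < p"
    with k have "?occ (k - p)" "k - p < i" using occ_p[of "k - p"] by auto
    then show False using not_less_Least[of "k - p" ?occ] by (simp add: i_def)
  qed
  have "real (p + i - k) \<le> K * real n"
  proof (cases "k + n \<le> p + i")
    case True
    show ?thesis
    proof (rule return_gap_le[OF K x _ True])
      fix j assume "j < n" then show "x (p + i + j) = x (k + j)" using k(2) occ_p[of i] i by simp
    next
      fix m assume "k < m" "m < p + i"
      then have "\<not> ?occ m" by (meson leD max)
      then show "\<exists>j<n. x (m + j) \<noteq> x (k + j)" using k(2) by auto
    qed (use False in simp)
  next
    \<comment> \<open>Overlapping occurrences give no return word, but their distance is below
      \<open>n\<close>, and \<open>1 \<le> K\<close>.\<close>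
    case False
    then have "real (p + i - k) \<le> 1 * real n" by simp
    also have "\<dots> \<le> K * real n"
      using recurrence_constant_ge_1[OF min K x] by (intro mult_right_mono) auto
    finally show ?thesis .
  qed
  also have "\<dots> \<le> real (nat \<lceil>K\<rceil> * n)"
    by (auto intro!: mult_right_mono real_nat_ceiling_ge)
  finally have "i \<le> nat \<lceil>K\<rceil> * n" using \<open>k < p\<close> by linarith
  with i show ?thesis by blast
qed simp

theorem theorem4p3:
  fixes A :: "'a set" and X :: "(nat \<Rightarrow> 'a) set" and K :: real
    and \<Phi> :: "(nat \<Rightarrow> 'a) \<Rightarrow> (nat \<Rightarrow> 'a)"
  assumes "linearly_recurrent A X"
    and "infinite X"
    and "recurrence_constant X K"
    and "shift_endomorphism A X \<Phi>"
  shows "\<exists>k n :: nat. 1 \<le> k \<and> real k \<le> 2 * (K + 1) * (2 * K + 3)\<^sup>2 \<and>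
           (\<forall>x\<in>X. (\<Phi> ^^ k) x = (left_shift ^^ n) x)"
proof -
  have min: "minimal_shift A X" using assms(1) by (simp add: linearly_recurrent_def)
  then have shift: "one_sided_shift A X" by (simp add: minimal_shift_def)
  then have closed: "closedin (full_shift_topology A) X" by (simp add: one_sided_shift_def)
  obtain r where r: "\<And>x y. x \<in> X \<Longrightarrow> y \<in> X \<Longrightarrow> (\<And>i. i < r \<Longrightarrow> x i = y i) \<Longrightarrow> \<Phi> x 0 = \<Phi> y 0"
    using endomorphism_local_rule[OF shift assms(4)] by blast
  interpret lr_endomorphism A X "nat \<lceil>K\<rceil>" \<Phi> r
  proof
    show "finite A" using shift by (simp add: one_sided_shift_def)
    show "x i \<in> A" if "x \<in> X" for x i
      using closedin_subset[OF closed] that by (auto simp: topspace_full_shift)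
    show "x \<in> X" if "\<And>m. \<exists>y\<in>X. \<forall>i<m. y i = x i" for x
      using closedin_full_shiftD[OF closed that] .
    show "left_shift x \<in> X" if "x \<in> X" for x
      using shift that by (auto simp: one_sided_shift_def)
    show "\<exists>i\<le>nat \<lceil>K\<rceil> * n. \<forall>j<n. x (i + j) = y j" if "x \<in> X" "y \<in> X" for x y n
      using linear_recurrence[OF min assms(3) that] .
    show "\<Phi> x \<in> X" if "x \<in> X" for x
      using assms(4) that by (auto simp: shift_endomorphism_def)
    show "\<exists>x\<in>X. \<Phi> x = y" if "y \<in> X" for y
      using assms(4) that unfolding shift_endomorphism_def by (metis imageE)
    show "\<Phi> (left_shift x) = left_shift (\<Phi> x)" if "x \<in> X" for x
      using assms(4) that by (auto simp: shift_endomorphism_def)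
  qed (fact assms(2) r)+
  obtain k n where k: "1 \<le> k" "k \<le> nat \<lceil>K\<rceil>" "\<forall>x\<in>X. (\<Phi> ^^ k) x = (left_shift ^^ n) x"
    using root_of_shift by blast
  then have "K > 0" by linarith
  \<comment> \<open>Rounding \<open>K\<close> up to an integer costs less than 1; the factor
    \<open>2 * (2 * K + 3)^2\<close> is at least 1.\<close>
  have "real k \<le> K + 1" using k(2) \<open>K > 0\<close> by linarith
  also have "\<dots> \<le> (K + 1) * (2 * (2 * K + 3)\<^sup>2)"
    using \<open>K > 0\<close> by (auto simp: mult_le_cancel_left1 intro: order_trans[OF one_le_power[of "2 * K + 3" 2]])
  also have "\<dots> = 2 * (K + 1) * (2 * K + 3)\<^sup>2" by simp
  finally show ?thesis using k by blast
qed

end
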